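(* Let $f\in\mathcal{HK}$ and $g\in L^1\cap\mathcal{BV}$. Then $f\ast g$ exists on $\mathbb{R}$ and $\|f\ast g\|\le\|f\|\,\|g\|_1$.
   Context: Functions are real-valued on $\mathbb{R}$ and all integrals are Henstock--Kurzweil integrals. $\mathcal{HK}$ is the set of Henstock--Kurzweil integrable functions on $\mathbb{R}$; $\mathcal{BV}$ the functions of bounded variation on $\mathbb{R}$. The Alexiewicz norm is $\|f\|=\sup_I\left|\int_If\right|$, the supremum being over all intervals $I\subset\mathbb{R}$; $\|g\|_1$ is the $L^1$ norm. The convolution is $f\ast g(x)=\int_{-\infty}^\infty f(x-t)g(t)\,dt$. *)

theory Defs
  imports "HOL-Analysis.Analysis"
begin

text \<open>
  The library's \<open>integrable_on\<close> and \<open>integral\<close> are the gauge (Henstock--Kurzweil) integral. On an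
  unbounded set they are limits of integrals over large bounded boxes, which on the real line is the
  usual Henstock--Kurzweil integral by Hake's theorem.
\<close>

definition bounded_variation :: "(real \<Rightarrow> real) \<Rightarrow> bool" where
  "bounded_variation g \<longleftrightarrow>
     (\<exists>V. \<forall>(n::nat) (x::nat \<Rightarrow> real).
        (\<forall>i<n. x i \<le> x (Suc i)) \<longrightarrow> (\<Sum>i<n. \<bar>g (x (Suc i)) - g (x i)\<bar>) \<le> V)"

text \<open>
  Intervals may be bounded or unbounded, open, closed or half-open. The supremum is meaningful for
  \<open>f\<close> integrable on the whole line: then \<open>f\<close> is integrable on every interval and the values
  are bounded.
\<close>

definition alexiewicz_norm :: "(real \<Rightarrow> real) \<Rightarrow> real" where
  "alexiewicz_norm f = (SUP I \<in> {I. is_interval I}. \<bar>integral I f\<bar>)"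

definition L1_norm :: "(real \<Rightarrow> real) \<Rightarrow> real" where
  "L1_norm g = integral UNIV (\<lambda>t. \<bar>g t\<bar>)"

definition conv :: "(real \<Rightarrow> real) \<Rightarrow> (real \<Rightarrow> real) \<Rightarrow> real \<Rightarrow> real" where
  "conv f g x = integral UNIV (\<lambda>t. f (x - t) * g t)"

end

theory Submission
  imports Defs
begin

text \<open>
  Since \<open>f\<close> need not be absolutely integrable, Fubini's theorem does not apply to
  \<open>f (x - t) * g t\<close>. The proof passes to a primitive \<open>F\<close> of \<open>f\<close>, which is bounded and uniformly
  continuous, so that \<open>\<Phi> x = integral UNIV (\<lambda>t. F (x - t) * g t)\<close> is an ordinary Lebesgue
  convolution, and shows that \<open>\<Phi>\<close> has derivative \<open>conv f g\<close>. The fundamental theorem of calculus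
  for the gauge integral then gives

    \<open>integral {a..b} (conv f g) = \<Phi> b - \<Phi> a = integral UNIV (\<lambda>t. (F (b - t) - F (a - t)) * g t)\<close>,

  where \<open>F (b - t) - F (a - t)\<close> is an integral of \<open>f\<close> over an interval and hence at most
  \<open>alexiewicz_norm f\<close> in absolute value. This is the norm inequality on compact intervals, and
  \<open>abs_integral_interval_le\<close> extends it to all intervals.

  Bounded variation enters through \<open>bounded_variation_multiplier\<close>: by the second mean value
  theorem, multiplying \<open>k\<close> by \<open>g\<close> enlarges the supremum of its integrals over intervals at most by
  a factor that depends only on \<open>g\<close>. Applied to \<open>k t = f (x - t)\<close> this gives the existence of the
  convolution. Applied to the error of the difference quotients of \<open>F\<close>, whose integrals over
  intervals are small uniformly although the error itself need not be, it gives
  \<open>convolution_has_derivative\<close>. Integrability of \<open>conv f g\<close> on the whole line follows from the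
  Cauchy criterion \<open>integrable_on_UNIV_iff_tails\<close>, whose condition at infinity is
  \<open>convolution_tails\<close>.
\<close>

section \<open>Functions of bounded variation as multipliers\<close>

text \<open>The first component is the total variation of \<open>g\<close> up to \<open>x\<close>: prolonging a chain that ends at
  \<open>x\<close> by a point \<open>y > x\<close> adds \<open>\<bar>g y - g x\<bar>\<close> to its sum, so both the variation and its difference
  with \<open>g\<close> increase.\<close>

lemma bounded_variation_decomposition:
  assumes "bounded_variation g"
  obtains p q :: "real \<Rightarrow> real" and M
  where "mono p" "mono q" "\<And>x. g x = p x - q x" "\<And>x. \<bar>p x\<bar> \<le> M" "\<And>x. \<bar>q x\<bar> \<le> M"
proof -
  define S where "S y = {(\<Sum>i<n. \<bar>g (x (Suc i)) - g (x i)\<bar>) |n x. (\<forall>i<n. x i \<le> x (Suc i)) \<and> x n = y}"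
    for y :: real
  obtain V where V: "\<And>(n::nat) x. (\<forall>i<n. x i \<le> x (Suc i)) \<Longrightarrow> (\<Sum>i<n. \<bar>g (x (Suc i)) - g (x i)\<bar>) \<le> V"
    using assms unfolding bounded_variation_def by blast
  have bdd: "bdd_above (S y)" for y
    unfolding S_def bdd_above_def using V by blast
  have zero: "0 \<in> S y" for y
    unfolding S_def by (rule CollectI, rule exI[of _ 0], rule exI[of _ "\<lambda>_. y"]) simp
  have extend: "s + \<bar>g y - g x\<bar> \<in> S y" if "s \<in> S x" "x \<le> y" for s x y
  proof -
    obtain n z where z: "\<forall>i<n. z i \<le> z (Suc i)" "z n = x" "s = (\<Sum>i<n. \<bar>g (z (Suc i)) - g (z i)\<bar>)"
      using \<open>s \<in> S x\<close> unfolding S_def by blast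
    define w where "w i = (if i \<le> n then z i else y)" for i
    have "(\<Sum>i<Suc n. \<bar>g (w (Suc i)) - g (w i)\<bar>) = s + \<bar>g y - g x\<bar>"
      using z by (simp add: w_def)
    moreover have "\<forall>i<Suc n. w i \<le> w (Suc i)" "w (Suc n) = y"
      using z \<open>x \<le> y\<close> by (auto simp: w_def less_Suc_eq)
    ultimately show ?thesis
      unfolding S_def by (intro CollectI exI[of _ "Suc n"] exI[of _ w] conjI) simp_all
  qed
  define p where "p x = Sup (S x)" for x
  have step: "p x + \<bar>g y - g x\<bar> \<le> p y" if "x \<le> y" for x y
  proof -
    have "p x \<le> p y - \<bar>g y - g x\<bar>"
      unfolding p_def
    proof (rule cSup_least)
      show "s \<le> Sup (S y) - \<bar>g y - g x\<bar>" if "s \<in> S x" for s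
        using cSup_upper[OF extend[OF that \<open>x \<le> y\<close>] bdd] by simp
    qed (use zero in blast)
    then show ?thesis by simp
  qed
  have p0: "0 \<le> p x" for x
    unfolding p_def by (rule cSup_upper[OF zero bdd])
  have pV: "p x \<le> V" for x
    unfolding p_def by (rule cSup_least) (use zero V in \<open>auto simp: S_def\<close>)
  have g0: "\<bar>g x\<bar> \<le> \<bar>g 0\<bar> + V" for x
    using step[of 0 x] step[of x 0] p0[of 0] p0[of x] pV[of 0] pV[of x]
    by (cases "0 \<le> x") auto
  show thesis
  proof
    show "mono p"
    proof (rule monoI)
      show "p x \<le> p y" if "x \<le> y" for x y
        using step[OF that] by linarith
    qed
    show "mono (\<lambda>x. p x - g x)"
    proof (rule monoI)
      show "p x - g x \<le> p y - g y" if "x \<le> y" for x y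
        using step[OF that] by linarith
    qed
    show "\<bar>p x\<bar> \<le> \<bar>g 0\<bar> + 2 * V" "\<bar>p x - g x\<bar> \<le> \<bar>g 0\<bar> + 2 * V" for x
      using g0[of x] p0[of x] pV[of x] by linarith+
  qed simp
qed

text \<open>By the second mean value theorem, the integral of \<open>k\<close> against a monotone function only sees
  the end values of that function and two integrals of \<open>k\<close>. So multiplication by \<open>g\<close> is bounded
  for the Alexiewicz norm, uniformly in the interval and in \<open>k\<close>.\<close>

lemma bounded_variation_multiplier:
  assumes "bounded_variation g"
  obtains C where "C > 0"
    "\<And>k a b e. \<lbrakk>k integrable_on {a..b}; a \<le> b;
        \<And>u v. \<lbrakk>a \<le> u; u \<le> v; v \<le> b\<rbrakk> \<Longrightarrow> \<bar>integral {u..v} k\<bar> \<le> e\<rbrakk>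
      \<Longrightarrow> (\<lambda>t. k t * g t) integrable_on {a..b} \<and> \<bar>integral {a..b} (\<lambda>t. k t * g t)\<bar> \<le> C * e"
proof -
  obtain p q M where pq: "mono p" "mono q" "\<And>x. g x = p x - q x"
    and M: "\<And>x. \<bar>p x\<bar> \<le> M" "\<And>x. \<bar>q x\<bar> \<le> M"
    using bounded_variation_decomposition[OF assms] by metis
  have monotone_case: "\<exists>i. ((\<lambda>t. h t * k t) has_integral i) {a..b} \<and> \<bar>i\<bar> \<le> 2 * M * e"
    if k: "k integrable_on {a..b}" and "a \<le> b" and "mono h" and hM: "\<And>x. \<bar>h x\<bar> \<le> M"
      and e: "\<And>u v. \<lbrakk>a \<le> u; u \<le> v; v \<le> b\<rbrakk> \<Longrightarrow> \<bar>integral {u..v} k\<bar> \<le> e"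
    for h k :: "real \<Rightarrow> real" and a b e
  proof -
    obtain c where c: "c \<in> {a..b}"
      and i: "((\<lambda>x. h x * k x) has_integral (h a * integral {a..c} k + h b * integral {c..b} k)) {a..b}"
      by (rule second_mean_value_theorem_full[OF k \<open>a \<le> b\<close>, of h]) (use \<open>mono h\<close> in \<open>blast dest: monoD\<close>)+
    have "0 \<le> M"
      using hM[of a] by linarith
    then have "\<bar>h a * integral {a..c} k\<bar> \<le> M * e" "\<bar>h b * integral {c..b} k\<bar> \<le> M * e"
      unfolding abs_mult using c hM e by (auto simp del: abs_mult intro!: mult_mono)
    then show ?thesis
      using i by (intro exI[of _ "h a * integral {a..c} k + h b * integral {c..b} k"] conjI) linarith+
  qed
  \<comment> \<open>Each of \<open>p\<close> and \<open>q\<close> contributes \<open>2 * M\<close>; the summand \<open>1\<close> makes the constant positive.\<close>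
  show thesis
  proof (rule that[of "4 * M + 1"])
    show "0 < 4 * M + 1"
      using M(1)[of 0] by linarith
    fix k :: "real \<Rightarrow> real" and a b e
    assume k: "k integrable_on {a..b}" and "a \<le> b"
      and e: "\<And>u v. \<lbrakk>a \<le> u; u \<le> v; v \<le> b\<rbrakk> \<Longrightarrow> \<bar>integral {u..v} k\<bar> \<le> e"
    obtain i where i: "((\<lambda>t. p t * k t) has_integral i) {a..b}" "\<bar>i\<bar> \<le> 2 * M * e"
      using monotone_case[OF k \<open>a \<le> b\<close> pq(1) M(1) e] by blast
    obtain j where j: "((\<lambda>t. q t * k t) has_integral j) {a..b}" "\<bar>j\<bar> \<le> 2 * M * e"
      using monotone_case[OF k \<open>a \<le> b\<close> pq(2) M(2) e] by blast
    have "((\<lambda>t. k t * g t) has_integral i - j) {a..b}"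
      using has_integral_diff[OF i(1) j(1)] by (simp add: pq(3) algebra_simps)
    moreover have "0 \<le> e"
      using e[of a a] \<open>a \<le> b\<close> by simp
    then have "\<bar>i - j\<bar> \<le> (4 * M + 1) * e"
      using i(2) j(2) by (simp add: algebra_simps)
    ultimately show "(\<lambda>t. k t * g t) integrable_on {a..b} \<and>
        \<bar>integral {a..b} (\<lambda>t. k t * g t)\<bar> \<le> (4 * M + 1) * e"
      by (metis has_integral_integrable integral_unique)
  qed
qed

section \<open>Integrability on the line\<close>

lemma ball_0_subset_Icc:
  fixes a b B :: real
  assumes "0 < B"
  shows "ball 0 B \<subseteq> {a..b} \<longleftrightarrow> a \<le> -B \<and> B \<le> b"
  using assms by (simp add: ball_eq_greaterThanLessThan greaterThanLessThan_subseteq_atLeastAtMost_iff)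

text \<open>The Cauchy form of Hake's theorem: local integrability and small integrals far out.\<close>

lemma integrable_on_UNIV_iff_tails:
  fixes k :: "real \<Rightarrow> real"
  shows "k integrable_on UNIV \<longleftrightarrow>
    (\<forall>a b. k integrable_on {a..b}) \<and>
    (\<forall>e>0. \<exists>B>0. \<forall>u v. u \<le> v \<and> (B \<le> u \<or> v \<le> -B) \<longrightarrow> \<bar>integral {u..v} k\<bar> \<le> e)"
    (is "_ \<longleftrightarrow> ?loc \<and> ?tails")
proof (intro iffI conjI)
  assume k: "k integrable_on UNIV"
  then show loc: ?loc
    unfolding integrable_alt[of k UNIV] by simp
  show ?tails
  proof (intro allI impI)
    fix e :: real
    assume "e > 0"
    then obtain B where "B > 0" and B: "\<And>a b c d. \<lbrakk>a \<le> -B; B \<le> b; c \<le> -B; B \<le> d\<rbrakk>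
        \<Longrightarrow> \<bar>integral {a..b} k - integral {c..d} k\<bar> < e"
      using k unfolding integrable_alt[of k UNIV] by (simp, metis ball_0_subset_Icc)
    show "\<exists>B>0. \<forall>u v. u \<le> v \<and> (B \<le> u \<or> v \<le> -B) \<longrightarrow> \<bar>integral {u..v} k\<bar> \<le> e"
    proof (intro exI conjI allI impI, rule \<open>B > 0\<close>)
      fix u v
      assume uv: "u \<le> v \<and> (B \<le> u \<or> v \<le> -B)"
      then show "\<bar>integral {u..v} k\<bar> \<le> e"
      proof (cases "B \<le> u")
        case True
        then have "integral {-B..u} k + integral {u..v} k = integral {-B..v} k"
          using uv \<open>B > 0\<close> loc by (intro Henstock_Kurzweil_Integration.integral_combine) auto
        then show ?thesis
          using B[of "-B" v "-B" u] True uv by simp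
      next
        case False
        then have "integral {u..v} k + integral {v..B} k = integral {u..B} k"
          using uv \<open>B > 0\<close> loc by (intro Henstock_Kurzweil_Integration.integral_combine) auto
        then show ?thesis
          using B[of u B v B] False uv by simp
      qed
    qed
  qed
next
  assume rhs: "?loc \<and> ?tails"
  then have loc: "k integrable_on {a..b}" for a b
    by blast
  have "\<exists>B>0. \<forall>a b c d. ball 0 B \<subseteq> cbox a b \<and> ball 0 B \<subseteq> cbox c d \<longrightarrow>
    norm (integral (cbox a b) k - integral (cbox c d) k) < e" if "e > 0" for e :: real
  proof -
    have "e/5 > 0"
      using that by simp
    then obtain B where "B > 0"
      and B: "\<And>u v. u \<le> v \<Longrightarrow> B \<le> u \<or> v \<le> -B \<Longrightarrow> \<bar>integral {u..v} k\<bar> \<le> e/5"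
      using rhs by meson
    have near: "\<bar>integral {a..b} k - integral {-B..B} k\<bar> \<le> 2 * (e/5)" if "a \<le> -B" "B \<le> b" for a b
    proof -
      have "integral {a..-B} k + integral {-B..b} k = integral {a..b} k"
        "integral {-B..B} k + integral {B..b} k = integral {-B..b} k"
        using that \<open>B > 0\<close> loc by (auto intro!: Henstock_Kurzweil_Integration.integral_combine)
      then show ?thesis
        using B[of a "-B"] B[of B b] that by linarith
    qed
    show ?thesis
    proof (intro exI conjI allI impI, rule \<open>B > 0\<close>)
      fix a b c d :: real
      assume "ball 0 B \<subseteq> cbox a b \<and> ball 0 B \<subseteq> cbox c d"
      then have "a \<le> -B" "B \<le> b" "c \<le> -B" "B \<le> d"
        by (simp_all add: ball_0_subset_Icc[OF \<open>B > 0\<close>])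
      then show "norm (integral (cbox a b) k - integral (cbox c d) k) < e"
        using near[of a b] near[of c d] \<open>e > 0\<close>
        unfolding real_norm_def cbox_interval by linarith
    qed
  qed
  then show "k integrable_on UNIV"
    unfolding integrable_alt[of k UNIV] using loc by simp
qed

text \<open>The intersection of an interval with a large compact one is a compact interval up to its end
  points, and if the integral over \<open>I\<close> exists it is a limit of integrals over such intersections.
  Otherwise \<open>integral I k\<close> is \<open>0\<close> by convention.\<close>

lemma abs_integral_interval_le:
  fixes k :: "real \<Rightarrow> real"
  assumes "is_interval I" and bound: "\<And>a b. a \<le> b \<Longrightarrow> \<bar>integral {a..b} k\<bar> \<le> C"
  shows "\<bar>integral I k\<bar> \<le> C"
proof -
  have "0 \<le> C"
    using bound[of 0 0] by simp
  have bounded_case: "\<bar>integral J k\<bar> \<le> C" if "is_interval J" "bounded J" for J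
  proof -
    have "convex J" "compact (closure J)"
      using that by (simp_all add: is_interval_convex)
    moreover have "connected (closure J)"
      using that by (simp add: is_interval_connected_1 connected_imp_connected_closure)
    ultimately obtain a b where ab: "closure J = {a..b}"
      using connected_compact_interval_1 by blast
    have "integral J k = integral {a..b} k"
      using has_integral_closure[OF negligible_convex_frontier[OF \<open>convex J\<close>], of k] ab
      by (metis integral_unique not_integrable_integral integrable_on_def)
    then show ?thesis
      using bound[of a b] \<open>0 \<le> C\<close> by (cases "a \<le> b") auto
  qed
  show ?thesis
  proof (cases "k integrable_on I")
    case False
    then show ?thesis
      using \<open>0 \<le> C\<close> by (simp add: not_integrable_integral)
  next
    case True
    have "\<bar>integral I k\<bar> \<le> C + e" if "e > 0" for e
    proof -
      have "(k has_integral integral I k) I"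
        using True by blast
      then obtain B where "B > 0" and B: "\<And>a b. ball 0 B \<subseteq> cbox a b \<Longrightarrow>
          norm (integral (cbox a b) (\<lambda>x. if x \<in> I then k x else 0) - integral I k) < e"
        using \<open>e > 0\<close> unfolding has_integral_alt' by blast
      have "\<bar>integral (I \<inter> {-B..B}) k - integral I k\<bar> < e"
        using B[of "-B" B] \<open>B > 0\<close> by (simp add: ball_0_subset_Icc integral_restrict_Int)
      moreover have "\<bar>integral (I \<inter> {-B..B}) k\<bar> \<le> C"
        using assms(1) by (intro bounded_case)
          (auto simp: is_interval_Int is_interval_cc intro: bounded_subset[OF bounded_closed_interval])
      ultimately show ?thesis by linarith
    qed
    then show ?thesis
      by (rule field_le_epsilon)
  qed
qed

lemma reflected_translate_has_integral:
  fixes f :: "real \<Rightarrow> real"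
  assumes "\<And>a b. a \<le> b \<Longrightarrow> (f has_integral F b - F a) {a..b}" and "a \<le> b"
  shows "((\<lambda>t. f (x - t)) has_integral F (x - a) - F (x - b)) {a..b}"
proof -
  have f: "(f has_integral F (x - a) - F (x - b)) (cbox (x - b) (x - a))"
    using assms by simp
  have "(\<lambda>t. x - t) ` {x - b..x - a} = {a..b}"
    by (simp add: image_diff_atLeastAtMost)
  then show ?thesis
    using has_integral_affinity[OF f, of "-1" x] by simp
qed

text \<open>The primitive \<open>integral {0..x} f - integral {x..0} f\<close> is the oriented integral from \<open>0\<close> to
  \<open>x\<close>: for every \<open>x\<close> at least one of the two terms is over an empty set or a point.\<close>

lemma locally_integrable_antiderivative:
  fixes f :: "real \<Rightarrow> real"
  assumes "\<And>a b. f integrable_on {a..b}"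
  obtains F where "\<And>a b. a \<le> b \<Longrightarrow> (f has_integral F b - F a) {a..b}"
proof
  fix a b :: real
  assume "a \<le> b"
  have comb: "integral {u..w} f + integral {w..v} f = integral {u..v} f" if "u \<le> w" "w \<le> v" for u v w
    using that assms by (intro Henstock_Kurzweil_Integration.integral_combine)
  have emp: "integral {u..v} f = 0" if "v \<le> u" for u v
    using that by (cases "u = v") auto
  define F where "F x = integral {0..x} f - integral {x..0} f" for x
  have "F b - F a = integral {a..b} f"
    using comb[of a 0 b] comb[of 0 a b] comb[of a b 0] emp[of 0 a] emp[of 0 b] emp[of a 0] emp[of b 0] \<open>a \<le> b\<close>
    unfolding F_def by linarith
  then show "(f has_integral (integral {0..b} f - integral {b..0} f)
      - (integral {0..a} f - integral {a..0} f)) {a..b}"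
    using assms[of a b] unfolding F_def by (metis integrable_integral)
qed

lemma antiderivative_continuous_on:
  fixes f F :: "real \<Rightarrow> real"
  assumes F: "\<And>a b. a \<le> b \<Longrightarrow> (f has_integral F b - F a) {a..b}"
  shows "continuous_on {a..b} F"
proof (cases "a \<le> b")
  case True
  have "continuous_on {a..b} (\<lambda>x. F a + integral {a..x} f)"
    using F[OF True] by (intro continuous_intros indefinite_integral_continuous_1) blast
  moreover have "F a + integral {a..x} f = F x" if "x \<in> {a..b}" for x
    using F[of a x] that by (simp add: integral_unique)
  ultimately show ?thesis
    by (rule continuous_on_eq)
qed simp

text \<open>On a large compact interval this is the theorem of Heine and Cantor; outside it, the tails of
  the integral leave no room for oscillation.\<close>

lemma antiderivative_bounded_uniformly_continuous:
  fixes f F :: "real \<Rightarrow> real"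
  assumes F: "\<And>a b. a \<le> b \<Longrightarrow> (f has_integral F b - F a) {a..b}"
    and f: "f integrable_on UNIV"
  shows "bounded (range F)" and "uniformly_continuous_on UNIV F"
proof -
  have tails: "\<exists>B>0. \<forall>u v. B \<le> u \<and> B \<le> v \<or> u \<le> -B \<and> v \<le> -B \<longrightarrow> \<bar>F v - F u\<bar> \<le> e" if "e > 0" for e
  proof -
    obtain B where "B > 0" and B: "\<And>u v. u \<le> v \<Longrightarrow> B \<le> u \<or> v \<le> -B \<Longrightarrow> \<bar>integral {u..v} f\<bar> \<le> e"
      using f \<open>e > 0\<close> unfolding integrable_on_UNIV_iff_tails by meson
    have "\<bar>F v - F u\<bar> \<le> e" if "B \<le> u \<and> B \<le> v \<or> u \<le> -B \<and> v \<le> -B" for u v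
      using B[of u v] B[of v u] integral_unique[OF F[of u v]] integral_unique[OF F[of v u]] that
      by (cases "u \<le> v") auto
    then show ?thesis using \<open>B > 0\<close> by blast
  qed
  show "bounded (range F)"
  proof -
    obtain B where "B > 0"
      and B: "\<And>u v. B \<le> u \<and> B \<le> v \<or> u \<le> -B \<and> v \<le> -B \<Longrightarrow> \<bar>F v - F u\<bar> \<le> 1"
      using tails[of 1] by auto
    have "bounded (F ` {-B..B})"
      by (intro compact_imp_bounded compact_continuous_image antiderivative_continuous_on[OF F]) auto
    then obtain D where D: "\<And>x. x \<in> {-B..B} \<Longrightarrow> \<bar>F x\<bar> \<le> D"
      unfolding bounded_iff by (metis image_eqI real_norm_def)
    have "\<bar>F x\<bar> \<le> D + 1" for x
      using B[of B x] B[of "-B" x] D[of x] D[of B] D[of "-B"] \<open>B > 0\<close>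
      by (cases "x < -B"; cases "x > B") auto
    then show ?thesis
      unfolding bounded_iff by auto
  qed
  show "uniformly_continuous_on UNIV F"
    unfolding uniformly_continuous_on_def
  proof (intro allI impI)
    fix e :: real
    assume "e > 0"
    then obtain B where "B > 0"
      and B: "\<And>u v. B \<le> u \<and> B \<le> v \<or> u \<le> -B \<and> v \<le> -B \<Longrightarrow> \<bar>F v - F u\<bar> \<le> e/2"
      using tails[of "e/2"] by auto
    have "uniformly_continuous_on {-B-1..B+1} F"
      by (intro compact_uniformly_continuous antiderivative_continuous_on[OF F]) auto
    then obtain d where "d > 0"
      and d: "\<And>x y. \<lbrakk>x \<in> {-B-1..B+1}; y \<in> {-B-1..B+1}; dist y x < d\<rbrakk> \<Longrightarrow> dist (F y) (F x) < e"
      using \<open>e > 0\<close> unfolding uniformly_continuous_on_def by metis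
    have "dist (F y) (F x) < e" if "dist y x < min d 1" for x y
    proof -
      \<comment> \<open>Points at distance less than \<open>1\<close> lie together in the compact interval or in one tail.\<close>
      consider "x \<in> {-B-1..B+1} \<and> y \<in> {-B-1..B+1}" | "B \<le> x \<and> B \<le> y \<or> x \<le> -B \<and> y \<le> -B"
        using \<open>dist y x < min d 1\<close> unfolding dist_real_def atLeastAtMost_iff by linarith
      then show ?thesis
        by cases (use that d B[of x y] \<open>e > 0\<close> in \<open>auto simp: dist_real_def\<close>)
    qed
    then show "\<exists>d>0. \<forall>x\<in>UNIV. \<forall>y\<in>UNIV. dist y x < d \<longrightarrow> dist (F y) (F x) < e"
      using \<open>d > 0\<close> by (intro exI[of _ "min d 1"]) auto
  qed
qed

section \<open>The convolution as a derivative\<close>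

text \<open>A primitive of \<open>t \<mapsto> F (x + h - t) - F (x - t) - h * f (x - t)\<close> is written with a
  primitive of \<open>F\<close>. By the mean value theorem for the latter, all integrals of this function are
  at most \<open>2 * \<omega> * \<bar>h\<bar>\<close>, where \<open>\<omega>\<close> is the oscillation of \<open>F\<close> at scale \<open>h\<close>. Multiplication
  by \<open>g\<close> preserves this smallness, which is the assertion on the difference quotients.\<close>

lemma convolution_has_derivative:
  fixes f g F :: "real \<Rightarrow> real"
  assumes F: "\<And>a b. a \<le> b \<Longrightarrow> (f has_integral F b - F a) {a..b}"
    and F_uc: "uniformly_continuous_on UNIV F"
    and g: "bounded_variation g"
    and Fg: "\<And>x. (\<lambda>t. F (x - t) * g t) integrable_on UNIV"
    and fg: "\<And>x. (\<lambda>t. f (x - t) * g t) integrable_on UNIV"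
  shows "((\<lambda>x. integral UNIV (\<lambda>t. F (x - t) * g t)) has_real_derivative conv f g x) (at x)"
proof -
  obtain C where "C > 0" and C: "\<And>k a b e. \<lbrakk>k integrable_on {a..b}; a \<le> b;
        \<And>u v. \<lbrakk>a \<le> u; u \<le> v; v \<le> b\<rbrakk> \<Longrightarrow> \<bar>integral {u..v} k\<bar> \<le> e\<rbrakk>
      \<Longrightarrow> (\<lambda>t. k t * g t) integrable_on {a..b} \<and> \<bar>integral {a..b} (\<lambda>t. k t * g t)\<bar> \<le> C * e"
    using bounded_variation_multiplier[OF g] by blast
  have F_cont: "isCont F y" for y
    using uniformly_continuous_imp_continuous[OF F_uc] by (simp add: continuous_on_eq_continuous_at)
  obtain P where P: "\<And>y. (P has_real_derivative F y) (at y)"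
    using einterval_antiderivative[of "-\<infinity>" \<infinity> F] F_cont
    by (auto simp: has_real_derivative_iff_has_vector_derivative)
  define \<Phi> where "\<Phi> x = integral UNIV (\<lambda>t. F (x - t) * g t)" for x
  have P_lin: "\<bar>P (y + h) - P y - h * F y\<bar> \<le> \<omega> * \<bar>h\<bar>"
    if "\<And>z. \<bar>z - y\<bar> \<le> \<bar>h\<bar> \<Longrightarrow> \<bar>F z - F y\<bar> \<le> \<omega>" for y h \<omega>
  proof -
    have "\<exists>z. \<bar>z - y\<bar> \<le> \<bar>h\<bar> \<and> P (y + h) - P y = h * F z"
    proof (cases "h = 0")
      case False
      then consider "y < y + h" | "y + h < y" by linarith
      then show ?thesis
      proof cases
        case 1
        then obtain z where "y < z" "z < y + h" "P (y + h) - P y = (y + h - y) * F z"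
          using MVT2[OF 1, of P F] P by auto
        then show ?thesis
          by (intro exI[of _ z]) auto
      next
        case 2
        then obtain z where "z > y + h" "z < y" "P y - P (y + h) = (y - (y + h)) * F z"
          using MVT2[OF 2, of P F] P by auto
        then show ?thesis
          by (intro exI[of _ z]) auto
      qed
    qed (use that in auto)
    then obtain z where z: "\<bar>z - y\<bar> \<le> \<bar>h\<bar>" "P (y + h) - P y = h * F z" by blast
    then have "\<bar>P (y + h) - P y - h * F y\<bar> = \<bar>h\<bar> * \<bar>F z - F y\<bar>"
      by (simp add: abs_mult[symmetric] algebra_simps)
    then show ?thesis
      using mult_left_mono[OF that[OF z(1)], of "\<bar>h\<bar>"] by (simp add: mult.commute)
  qed
  have increment: "\<bar>\<Phi> (x + h) - \<Phi> x - h * conv f g x\<bar> \<le> C * (2 * (\<omega> * \<bar>h\<bar>))"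
    if \<omega>: "\<And>y z. \<bar>z - y\<bar> \<le> \<bar>h\<bar> \<Longrightarrow> \<bar>F z - F y\<bar> \<le> \<omega>" for h \<omega>
  proof -
    define k where "k t = F (x + h - t) - F (x - t) - h * f (x - t)" for t
    define K where "K t = P (x - t + h) - P (x - t) - h * F (x - t)" for t
    have k: "(k has_integral K a - K b) {a..b}" if "a \<le> b" for a b
    proof -
        have "(F has_integral P v - P u) {u..v}" if "u \<le> v" for u v
      proof (rule fundamental_theorem_of_calculus[OF that])
        show "(P has_vector_derivative F y) (at y within {u..v})" for y
          using P[of y] unfolding has_real_derivative_iff_has_vector_derivative
          by (rule has_vector_derivative_at_within)
      qed
      note shifted = reflected_translate_has_integral[OF this \<open>a \<le> b\<close>]
      have "(k has_integral (P (x + h - a) - P (x + h - b)) - (P (x - a) - P (x - b))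
          - h * (F (x - a) - F (x - b))) {a..b}"
        unfolding k_def
        by (intro has_integral_diff shifted has_integral_mult_right
            reflected_translate_has_integral[OF F \<open>a \<le> b\<close>])
      then show ?thesis
        by (simp add: K_def algebra_simps)
    qed
    have K: "\<bar>K t\<bar> \<le> \<omega> * \<bar>h\<bar>" for t
      unfolding K_def by (rule P_lin[OF \<omega>])
    have small: "\<bar>integral {u..v} k\<bar> \<le> 2 * (\<omega> * \<bar>h\<bar>)" if "u \<le> v" for u v
      using integral_unique[OF k[OF that]] K[of u] K[of v] by linarith
    have "\<bar>integral UNIV (\<lambda>t. k t * g t)\<bar> \<le> C * (2 * (\<omega> * \<bar>h\<bar>))"
    proof (rule abs_integral_interval_le[OF is_interval_univ])
      show "\<bar>integral {a..b} (\<lambda>t. k t * g t)\<bar> \<le> C * (2 * (\<omega> * \<bar>h\<bar>))" if "a \<le> b" for a b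
        using C[of k a b "2 * (\<omega> * \<bar>h\<bar>)"] k[OF that] that small by blast
    qed
    moreover have "((\<lambda>t. F (x + h - t) * g t - F (x - t) * g t - h * (f (x - t) * g t))
        has_integral \<Phi> (x + h) - \<Phi> x - h * conv f g x) UNIV"
      unfolding \<Phi>_def conv_def
      by (intro has_integral_diff has_integral_mult_right integrable_integral Fg fg)
    then have "integral UNIV (\<lambda>t. k t * g t) = \<Phi> (x + h) - \<Phi> x - h * conv f g x"
      by (simp add: k_def algebra_simps integral_unique)
    ultimately show ?thesis by simp
  qed
  have "(\<lambda>h. (\<Phi> (x + h) - \<Phi> x) / h) \<midarrow>0\<rightarrow> conv f g x"
  proof (rule LIM_I)
    fix e :: real
    assume "e > 0"
    define \<omega> where "\<omega> = e / (4 * C)"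
    have "\<omega> > 0"
      using \<open>e > 0\<close> \<open>C > 0\<close> by (simp add: \<omega>_def)
    then obtain d where "d > 0" and d: "\<And>y z. \<bar>z - y\<bar> < d \<Longrightarrow> \<bar>F z - F y\<bar> < \<omega>"
      using F_uc unfolding uniformly_continuous_on_def dist_real_def by (metis UNIV_I)
    have "norm ((\<Phi> (x + h) - \<Phi> x) / h - conv f g x) < e" if "h \<noteq> 0" "norm (h - 0) < d" for h
    proof -
      have "\<bar>\<Phi> (x + h) - \<Phi> x - h * conv f g x\<bar> \<le> C * (2 * (\<omega> * \<bar>h\<bar>))"
        by (rule increment) (use d that in \<open>force intro: less_imp_le\<close>)
      also have "\<dots> = e / 2 * \<bar>h\<bar>"
        using \<open>C > 0\<close> by (simp add: \<omega>_def)
      also have "\<dots> < e * \<bar>h\<bar>"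
        using \<open>e > 0\<close> that(1) by simp
      finally have "\<bar>\<Phi> (x + h) - \<Phi> x - h * conv f g x\<bar> / \<bar>h\<bar> < e"
        using that(1) by (simp add: pos_divide_less_eq)
      then show ?thesis
        using that(1) by (simp add: abs_divide[symmetric] diff_divide_distrib)
    qed
    then show "\<exists>d>0. \<forall>h. h \<noteq> 0 \<and> norm (h - 0) < d \<longrightarrow>
        norm ((\<Phi> (x + h) - \<Phi> x) / h - conv f g x) < e"
      using \<open>d > 0\<close> by blast
  qed
  then show ?thesis
    unfolding \<Phi>_def DERIV_def .
qed

text \<open>For large \<open>\<bar>u\<bar>\<close> and \<open>\<bar>v\<bar>\<close> of the same sign, \<open>F (v - t) - F (u - t)\<close> is small as long as
  \<open>t\<close> stays in \<open>{-N..N}\<close>; elsewhere it is bounded, and the integral of \<open>\<bar>g\<bar>\<close> is small.\<close>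

lemma convolution_tails:
  fixes F g :: "real \<Rightarrow> real"
  assumes F_bound: "\<And>x. \<bar>F x\<bar> \<le> D"
    and F_tails: "\<And>e. e > 0 \<Longrightarrow>
      \<exists>B>0. \<forall>u v. u \<le> v \<and> (B \<le> u \<or> v \<le> -B) \<longrightarrow> \<bar>F v - F u\<bar> \<le> e"
    and Fg: "\<And>x. (\<lambda>t. F (x - t) * g t) integrable_on UNIV"
    and g: "g absolutely_integrable_on UNIV"
    and "e > 0"
  shows "\<exists>B>0. \<forall>u v. u \<le> v \<and> (B \<le> u \<or> v \<le> -B) \<longrightarrow>
    \<bar>integral UNIV (\<lambda>t. F (v - t) * g t) - integral UNIV (\<lambda>t. F (u - t) * g t)\<bar> \<le> e"
proof -
  define L where "L = integral UNIV (\<lambda>t. \<bar>g t\<bar>)"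
  have abs_g: "(\<lambda>t. \<bar>g t\<bar>) integrable_on UNIV"
    using g unfolding absolutely_integrable_on_def by simp
  then have g_L: "((\<lambda>t. \<bar>g t\<bar>) has_integral L) UNIV"
    unfolding L_def by blast
  have "0 \<le> L"
    using has_integral_nonneg[OF g_L] by simp
  have "0 \<le> D"
    using F_bound[of 0] by linarith
  \<comment> \<open>Here and in \<open>\<eta>\<close> below, the added \<open>1\<close> only keeps the denominator positive.\<close>
  have "e / (2 * (2 * D + 1)) > 0"
    using \<open>e > 0\<close> \<open>0 \<le> D\<close> by simp
  then obtain N where "N > 0" and N: "\<And>a b. ball 0 N \<subseteq> cbox a b \<Longrightarrow>
      norm (integral (cbox a b) (\<lambda>t. if t \<in> UNIV then \<bar>g t\<bar> else 0) - L) < e / (2 * (2 * D + 1))"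
    using g_L unfolding has_integral_alt' by blast
  define T where "T = integral {-N..N} (\<lambda>t. \<bar>g t\<bar>)"
  have T: "((\<lambda>t. if t \<in> {-N..N} then \<bar>g t\<bar> else 0) has_integral T) UNIV"
    unfolding T_def has_integral_restrict_UNIV
    using abs_g unfolding integrable_on_UNIV_iff_tails by blast
  have "L - T \<le> e / (2 * (2 * D + 1))"
    using N[of "-N" N] \<open>N > 0\<close> by (simp add: T_def ball_0_subset_Icc)
  then have "2 * D * (L - T) \<le> 2 * D * (e / (2 * (2 * D + 1)))"
    using \<open>0 \<le> D\<close> by (intro mult_left_mono) auto
  also have "\<dots> \<le> e / 2"
    using \<open>0 \<le> D\<close> \<open>e > 0\<close> by (simp add: field_simps)
  finally have far: "2 * D * (L - T) \<le> e / 2" .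
  define \<eta> where "\<eta> = e / (2 * (L + 1))"
  have "\<eta> > 0"
    using \<open>0 \<le> L\<close> \<open>e > 0\<close> by (simp add: \<eta>_def)
  then obtain B where "B > 0"
    and B: "\<And>u v. u \<le> v \<and> (B \<le> u \<or> v \<le> -B) \<Longrightarrow> \<bar>F v - F u\<bar> \<le> \<eta>"
    using F_tails by meson
  have near: "\<eta> * L \<le> e / 2"
    using \<open>0 \<le> L\<close> \<open>e > 0\<close> by (simp add: \<eta>_def field_simps)
  show ?thesis
  proof (intro exI[of _ "B + N"] conjI allI impI)
    fix u v
    assume uv: "u \<le> v \<and> (B + N \<le> u \<or> v \<le> - (B + N))"
    let ?m = "\<lambda>t. \<eta> * \<bar>g t\<bar> + 2 * D * (\<bar>g t\<bar> - (if t \<in> {-N..N} then \<bar>g t\<bar> else 0))"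
    have m: "(?m has_integral \<eta> * L + 2 * D * (L - T)) UNIV"
      by (intro has_integral_add has_integral_diff has_integral_mult_right g_L T)
    have diff: "((\<lambda>t. F (v - t) * g t - F (u - t) * g t) has_integral
        integral UNIV (\<lambda>t. F (v - t) * g t) - integral UNIV (\<lambda>t. F (u - t) * g t)) UNIV"
      by (intro has_integral_diff integrable_integral Fg)
    have pointwise: "norm (F (v - t) * g t - F (u - t) * g t) \<le> ?m t" for t
    proof -
      have *: "norm (F (v - t) * g t - F (u - t) * g t) = \<bar>F (v - t) - F (u - t)\<bar> * \<bar>g t\<bar>"
        by (simp add: abs_mult[symmetric] left_diff_distrib)
      show ?thesis
      proof (cases "t \<in> {-N..N}")
        case True
        then have "\<bar>F (v - t) - F (u - t)\<bar> \<le> \<eta>"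
          using uv by (intro B) auto
        then show ?thesis
          unfolding * using True by (simp add: mult_right_mono)
      next
        case False
        have "\<bar>F (v - t) - F (u - t)\<bar> \<le> \<eta> + 2 * D"
          using F_bound[of "v - t"] F_bound[of "u - t"] \<open>\<eta> > 0\<close> by linarith
        then have "\<bar>F (v - t) - F (u - t)\<bar> * \<bar>g t\<bar> \<le> (\<eta> + 2 * D) * \<bar>g t\<bar>"
          by (rule mult_right_mono) simp
        then show ?thesis
          unfolding * if_not_P[OF False] by (simp add: algebra_simps)
      qed
    qed
    have "norm (integral UNIV (\<lambda>t. F (v - t) * g t - F (u - t) * g t)) \<le> integral UNIV ?m"
      by (rule Henstock_Kurzweil_Integration.integral_norm_bound_integral
          [OF has_integral_integrable[OF diff] has_integral_integrable[OF m] pointwise])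
    then show "\<bar>integral UNIV (\<lambda>t. F (v - t) * g t) - integral UNIV (\<lambda>t. F (u - t) * g t)\<bar> \<le> e"
      using near far unfolding integral_unique[OF diff] integral_unique[OF m] by simp
  qed (use \<open>B > 0\<close> \<open>N > 0\<close> in simp)
qed

section \<open>Young's inequality for the Alexiewicz norm\<close>

lemma abs_integral_le_alexiewicz_norm:
  assumes "f integrable_on UNIV" and "is_interval I"
  shows "\<bar>integral I f\<bar> \<le> alexiewicz_norm f"
proof -
  obtain F where F: "\<And>a b. a \<le> b \<Longrightarrow> (f has_integral F b - F a) {a..b}"
    using locally_integrable_antiderivative assms(1) integrable_on_UNIV_iff_tails by metis
  obtain D where D: "\<And>x. \<bar>F x\<bar> \<le> D"
    using antiderivative_bounded_uniformly_continuous(1)[OF F assms(1)] by (auto simp: bounded_iff)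
  have "\<bar>integral J f\<bar> \<le> 2 * D" if "is_interval J" for J
  proof (rule abs_integral_interval_le[OF that])
    show "\<bar>integral {a..b} f\<bar> \<le> 2 * D" if "a \<le> b" for a b
      using integral_unique[OF F[OF that]] D[of a] D[of b] by linarith
  qed
  then have "bdd_above ((\<lambda>I. \<bar>integral I f\<bar>) ` {I. is_interval I})"
    by (intro bdd_aboveI2[where M = "2 * D"]) simp
  then show ?thesis
    unfolding alexiewicz_norm_def using assms(2) by (intro cSUP_upper) auto
qed

text \<open>Reflection and translation preserve the tail conditions for \<open>f\<close> up to an enlargement of the
  bound \<open>B\<close> by \<open>\<bar>x\<bar>\<close>, and multiplication by \<open>g\<close> up to a constant factor.\<close>

lemma convolution_integrand_integrable:
  fixes f g :: "real \<Rightarrow> real"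
  assumes f: "f integrable_on UNIV" and g: "bounded_variation g"
  shows "(\<lambda>t. f (x - t) * g t) integrable_on UNIV"
proof -
  obtain F where F: "\<And>a b. a \<le> b \<Longrightarrow> (f has_integral F b - F a) {a..b}"
    using locally_integrable_antiderivative f integrable_on_UNIV_iff_tails by metis
  obtain C where "C > 0" and C: "\<And>k a b e. \<lbrakk>k integrable_on {a..b}; a \<le> b;
        \<And>u v. \<lbrakk>a \<le> u; u \<le> v; v \<le> b\<rbrakk> \<Longrightarrow> \<bar>integral {u..v} k\<bar> \<le> e\<rbrakk>
      \<Longrightarrow> (\<lambda>t. k t * g t) integrable_on {a..b} \<and> \<bar>integral {a..b} (\<lambda>t. k t * g t)\<bar> \<le> C * e"
    using bounded_variation_multiplier[OF g] by blast
  have reflected: "(\<lambda>t. f (x - t)) integrable_on {a..b}"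
    "integral {a..b} (\<lambda>t. f (x - t)) = integral {x - b..x - a} f" if "a \<le> b" for a b
    using reflected_translate_has_integral[OF F that, of x] F[of "x - b" "x - a"] that
    by (auto simp: integral_unique)
  show ?thesis
    unfolding integrable_on_UNIV_iff_tails
  proof (intro conjI allI impI)
    fix a b :: real
    show "(\<lambda>t. f (x - t) * g t) integrable_on {a..b}"
    proof (cases "a \<le> b")
      case True
      have "\<bar>integral {u..v} (\<lambda>t. f (x - t))\<bar> \<le> alexiewicz_norm f" if "u \<le> v" for u v
        using reflected(2)[OF that] abs_integral_le_alexiewicz_norm[OF f is_interval_cc] by simp
      then show ?thesis
        using C[OF reflected(1)[OF True] True] by blast
    qed (simp add: integrable_on_empty)
  next
    fix e :: real
    assume "e > 0"
    then have "e / C > 0"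
      using \<open>C > 0\<close> by simp
    then obtain B where "B > 0"
      and B: "\<And>u v. u \<le> v \<and> (B \<le> u \<or> v \<le> -B) \<Longrightarrow> \<bar>integral {u..v} f\<bar> \<le> e / C"
      using f unfolding integrable_on_UNIV_iff_tails by meson
    show "\<exists>B>0. \<forall>u v. u \<le> v \<and> (B \<le> u \<or> v \<le> - B) \<longrightarrow>
        \<bar>integral {u..v} (\<lambda>t. f (x - t) * g t)\<bar> \<le> e"
    proof (intro exI[of _ "B + \<bar>x\<bar>"] conjI allI impI)
      fix u v
      assume uv: "u \<le> v \<and> (B + \<bar>x\<bar> \<le> u \<or> v \<le> - (B + \<bar>x\<bar>))"
      have "\<bar>integral {r..s} (\<lambda>t. f (x - t))\<bar> \<le> e / C" if "u \<le> r" "r \<le> s" "s \<le> v" for r s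
      proof -
        have "x - s \<le> x - r \<and> (B \<le> x - s \<or> x - r \<le> - B)"
          using uv that by linarith
        then show ?thesis
          using reflected(2)[OF that(2)] B by simp
      qed
      then have "\<bar>integral {u..v} (\<lambda>t. f (x - t) * g t)\<bar> \<le> C * (e / C)"
        using C[OF reflected(1), of u v "e / C"] uv by blast
      then show "\<bar>integral {u..v} (\<lambda>t. f (x - t) * g t)\<bar> \<le> e"
        using \<open>C > 0\<close> by simp
    qed (use \<open>B > 0\<close> in simp)
  qed
qed

theorem proposition13:
  fixes f g :: "real \<Rightarrow> real"
  assumes "f integrable_on UNIV"
    and "g absolutely_integrable_on UNIV"
    and "bounded_variation g"
  shows "(\<forall>x. (\<lambda>t. f (x - t) * g t) integrable_on UNIV) \<and>
         conv f g integrable_on UNIV \<and>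
         alexiewicz_norm (conv f g) \<le> alexiewicz_norm f * L1_norm g"
proof -
  note f = assms(1) and fg = convolution_integrand_integrable[OF assms(1,3)]
  obtain F where F: "\<And>a b. a \<le> b \<Longrightarrow> (f has_integral F b - F a) {a..b}"
    using locally_integrable_antiderivative f integrable_on_UNIV_iff_tails by metis
  note F_bdd = antiderivative_bounded_uniformly_continuous(1)[OF F f]
    and F_uc = antiderivative_bounded_uniformly_continuous(2)[OF F f]
  obtain D where D: "\<And>x. \<bar>F x\<bar> \<le> D"
    using F_bdd by (auto simp: bounded_iff)
  have abs_g: "(\<lambda>t. \<bar>g t\<bar>) integrable_on UNIV"
    using assms(2) unfolding absolutely_integrable_on_def by simp
  have Fg: "(\<lambda>t. F (x - t) * g t) integrable_on UNIV" for x
  proof -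
    have "continuous_on UNIV (\<lambda>t. F (x - t))"
      by (intro continuous_on_compose2[OF uniformly_continuous_imp_continuous[OF F_uc]] continuous_intros) auto
    then have "(\<lambda>t. F (x - t)) \<in> borel_measurable (lebesgue_on UNIV)"
      by (intro continuous_imp_measurable_on_sets_lebesgue) auto
    moreover have "bounded ((\<lambda>t. F (x - t)) ` UNIV)"
      by (rule bounded_subset[OF F_bdd]) auto
    ultimately have "(\<lambda>t. F (x - t) * g t) absolutely_integrable_on UNIV"
      by (intro absolutely_integrable_bounded_measurable_product_real assms(2)) auto
    then show ?thesis
      unfolding absolutely_integrable_on_def by blast
  qed
  define \<Phi> where "\<Phi> x = integral UNIV (\<lambda>t. F (x - t) * g t)" for x
  have conv: "(conv f g has_integral \<Phi> b - \<Phi> a) {a..b}" if "a \<le> b" for a b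
  proof (rule fundamental_theorem_of_calculus[OF that])
    show "(\<Phi> has_vector_derivative conv f g x) (at x within {a..b})" for x
      using convolution_has_derivative[OF F F_uc assms(3) Fg fg, of x]
      unfolding \<Phi>_def has_real_derivative_iff_has_vector_derivative
      by (rule has_vector_derivative_at_within)
  qed
  have F_tails: "\<exists>B>0. \<forall>u v. u \<le> v \<and> (B \<le> u \<or> v \<le> -B) \<longrightarrow> \<bar>F v - F u\<bar> \<le> e" if "e > 0" for e
    using f that integral_unique[OF F] unfolding integrable_on_UNIV_iff_tails by metis
  have "conv f g integrable_on UNIV"
    unfolding integrable_on_UNIV_iff_tails
  proof (intro conjI allI impI)
    show "conv f g integrable_on {a..b}" for a b
      using conv[of a b] by (cases "a \<le> b") auto
    show "\<exists>B>0. \<forall>u v. u \<le> v \<and> (B \<le> u \<or> v \<le> -B) \<longrightarrow> \<bar>integral {u..v} (conv f g)\<bar> \<le> e"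
      if "e > 0" for e
      using convolution_tails[OF D F_tails Fg assms(2) that] integral_unique[OF conv]
      unfolding \<Phi>_def by metis
  qed
  moreover have "alexiewicz_norm (conv f g) \<le> alexiewicz_norm f * L1_norm g"
    unfolding alexiewicz_norm_def[of "conv f g"]
  proof (rule cSUP_least)
    fix I :: "real set"
    assume "I \<in> {I. is_interval I}"
    then have "is_interval I" by simp
    then show "\<bar>integral I (conv f g)\<bar> \<le> alexiewicz_norm f * L1_norm g"
    proof (rule abs_integral_interval_le)
      fix a b :: real
      assume "a \<le> b"
      have "\<bar>F (b - t) - F (a - t)\<bar> \<le> alexiewicz_norm f" for t
        using abs_integral_le_alexiewicz_norm[OF f is_interval_cc, of "a - t" "b - t"]
          integral_unique[OF F[of "a - t" "b - t"]] \<open>a \<le> b\<close> by simp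
      then have pointwise: "norm (F (b - t) * g t - F (a - t) * g t) \<le> alexiewicz_norm f * \<bar>g t\<bar>" for t
        by (simp add: abs_mult mult_right_mono flip: left_diff_distrib)
      have "integral {a..b} (conv f g) = integral UNIV (\<lambda>t. F (b - t) * g t - F (a - t) * g t)"
        using integral_unique[OF conv[OF \<open>a \<le> b\<close>]]
        by (simp add: \<Phi>_def Henstock_Kurzweil_Integration.integral_diff Fg)
      also have "norm \<dots> \<le> integral UNIV (\<lambda>t. alexiewicz_norm f * \<bar>g t\<bar>)"
        by (rule Henstock_Kurzweil_Integration.integral_norm_bound_integral[OF _ _ pointwise])
          (intro Henstock_Kurzweil_Integration.integrable_diff integrable_on_mult_right Fg abs_g)+
      finally show "\<bar>integral {a..b} (conv f g)\<bar> \<le> alexiewicz_norm f * L1_norm g"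
        by (simp add: L1_norm_def)
    qed
  qed (use is_interval_empty in blast)
  ultimately show ?thesis
    using fg by blast
qed

end
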